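(* Fix $p\in(0,1)\setminus\{1/2\}$ and $c>0$, and let $m_n=\lfloor c n^2\rfloor$. Then, as $n\to \infty$, $$\operatorname{sep}\big(\nu^{(p)}_{n,m_n},\nu_n\big)\longrightarrow 1-\exp\left\{-\frac{|2p-1|}{2c}\right\}.$$
   Context: $(m,p)$-shelf shuffle: a deck of cards labelled $1,\ldots,n$, arranged in increasing order from top to bottom, is dealt sequentially from the bottom (so the cards are dealt in the order $n,n-1,\ldots,1$). Each card is assigned one of $m$ labelled shelves, independently and uniformly at random, and is placed at the top of the existing pile on that shelf with probability $p$ and at the bottom of it with probability $1-p$, independently of everything else (a card assigned to an empty shelf simply starts the pile). The shuffled deck is formed by joining the piles in the order of the shelves $1,\ldots,m$, and is read from top to bottom as a permutation $\pi=(\pi_1,\ldots,\pi_n)\in S_n$ in one-line notation. The law of this random permutation is denoted $\nu_{n,m}^{(p)}$. $\nu_n$ is the uniform measure on $S_n$. For a probability measure $\mu$ on $S_n$, the separation is $$\operatorname{sep}(\mu,\nu_n)=\max_{\pi\in S_n}\left(1-\frac{\mu(\pi)}{\nu_n(\pi)}\right).$$ *)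

theory Defs
  imports "HOL-Probability.Probability" "HOL-Combinatorics.Multiset_Permutations"
begin

text \<open>
  The symmetric group on \<open>{1..n}\<close> is represented in one-line notation, i.e. by the set
  \<open>permutations_of_set {1..n}\<close> of all lists enumerating \<open>{1..n}\<close> without repetition.
  Piles and decks are lists read from top to bottom.
\<close>

definition place_card :: "nat \<Rightarrow> nat \<times> bool \<Rightarrow> (nat \<Rightarrow> nat list) \<Rightarrow> nat \<Rightarrow> nat list" where
  "place_card x = (\<lambda>(s, on_top) piles.
     piles(s := (if on_top then x # piles s else piles s @ [x])))"

text \<open>
  \<open>deal_cards m p k piles\<close> is the law of the piles after the cards \<open>k, k - 1, \<dots>, 1\<close> have been
  dealt, in this order, onto the initial configuration \<open>piles\<close>.  It is only meaningful for
  \<open>m \<ge> 1\<close> and \<open>0 \<le> p \<le> 1\<close>.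
\<close>

primrec deal_cards ::
    "nat \<Rightarrow> real \<Rightarrow> nat \<Rightarrow> (nat \<Rightarrow> nat list) \<Rightarrow> (nat \<Rightarrow> nat list) pmf" where
  "deal_cards m p 0 piles = return_pmf piles"
| "deal_cards m p (Suc k) piles =
     bind_pmf (pair_pmf (pmf_of_set {1..m}) (bernoulli_pmf p))
       (\<lambda>a. deal_cards m p k (place_card (Suc k) a piles))"

definition shelf_shuffle :: "nat \<Rightarrow> nat \<Rightarrow> real \<Rightarrow> nat list pmf" where
  "shelf_shuffle n m p =
     map_pmf (\<lambda>piles. concat (map piles [1..<Suc m])) (deal_cards m p n (\<lambda>_. []))"

definition uniform_perm :: "nat \<Rightarrow> nat list pmf" where
  "uniform_perm n = pmf_of_set (permutations_of_set {1..n})"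

definition separation :: "nat \<Rightarrow> nat list pmf \<Rightarrow> nat list pmf \<Rightarrow> real" where
  "separation n \<mu> \<nu> = (MAX \<pi>\<in>permutations_of_set {1..n}. 1 - pmf \<mu> \<pi> / pmf \<nu> \<pi>)"

lemma mset_concat_place_card:
  assumes "s \<in> {1..m}"
  shows "mset (concat (map (place_card x (s, b) piles) [1..<Suc m]))
       = add_mset x (mset (concat (map piles [1..<Suc m])))"
proof -
  have *: "mset (concat (map f [1..<Suc m])) = (\<Sum>i\<in>{1..m}. mset (f i))"
    for f :: "nat \<Rightarrow> nat list"
    by (induction m) (auto simp: add.commute)
  have "(\<Sum>i\<in>{1..m}. mset (place_card x (s, b) piles i))
      = (\<Sum>i\<in>{1..m}. mset (piles i) + (if i = s then {#x#} else {#}))"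
    by (intro sum.cong) (auto simp: place_card_def)
  also have "\<dots> = add_mset x (\<Sum>i\<in>{1..m}. mset (piles i))"
    using assms by (simp add: sum.distrib)
  finally show ?thesis
    unfolding * .
qed

lemma mset_concat_deal_cards:
  assumes "m > 0" "piles' \<in> set_pmf (deal_cards m p k piles)"
  shows "mset (concat (map piles' [1..<Suc m]))
       = mset (concat (map piles [1..<Suc m])) + mset_set {1..k}"
  using assms(2)
proof (induction k arbitrary: piles)
  case 0
  then show ?case by simp
next
  case (Suc k)
  then obtain s b where "s \<in> {1..m}"
    and *: "piles' \<in> set_pmf (deal_cards m p k (place_card (Suc k) (s, b) piles))"
    using assms(1) by (auto simp: set_pmf_of_set)
  with Suc.IH[OF *] show ?case
    by (simp only: mset_concat_place_card) (simp add: atLeastAtMostSuc_conv)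
qed

lemma set_pmf_shelf_shuffle:
  assumes "m > 0"
  shows "set_pmf (shelf_shuffle n m p) \<subseteq> permutations_of_set {1..n}"
proof
  fix xs
  assume "xs \<in> set_pmf (shelf_shuffle n m p)"
  then have "mset xs = mset_set {1..n}"
    using mset_concat_deal_cards[OF assms, where piles = "\<lambda>_. []"]
    by (fastforce simp: shelf_shuffle_def simp del: upt_Suc)
  then show "xs \<in> permutations_of_set {1..n}"
    by (metis finite_atLeastAtMost finite_set_mset_mset_set permutations_of_setI
        set_mset_mset distinct_count_atmost_1 count_mset_set' count_mset)
qed

end

theory Submission
  imports Defs "HOL-Computational_Algebra.Formal_Power_Series" "HOL-Library.Sublist"
begin

text \<open>
  Write \<open>r = min p (1 - p)\<close> and call \<open>n! * P(\<pi>)\<close> the normalised probability of a deck \<open>\<pi>\<close>. The separation is one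
  minus the minimum of the normalised probability over all decks, and the claim is that this minimum tends to
  \<open>exp (- (1 - 2 r) / (2 c))\<close>, since \<open>\<bar>2 p - 1\<bar> = 1 - 2 r\<close>.

  A deck is obtained from the final piles by concatenation, so \<open>m\<^sup>n * P(\<pi>)\<close> is the sum over all ways of cutting
  \<open>\<pi>\<close> into \<open>m\<close> consecutive blocks of the product of the weights of the blocks, where the weight of a block is the
  probability that its cards, dealt on one shelf, produce this pile (\<open>pmf_shelf_shuffle\<close>). When these weights are
  compared with weights that depend only on the length of the block, the sum becomes the coefficient of \<open>x\<^sup>n\<close> in the
  \<open>m\<close>-th power of a generating function (\<open>sum_splits_fps\<close>).

  The blocks with at most one card have weight 1, and a block with two cards has weight \<open>p\<close> or \<open>1 - p\<close>, according
  to whether it is an ascent or a descent. So for every deck the generating function \<open>1 + x + r x\<^sup>2\<close> gives a lower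
  bound (\<open>pmf_shelf_shuffle_ge\<close>). For one monotone deck, in which every pile is ascending if \<open>p \<le> 1/2\<close> and descending
  otherwise, a block of length \<open>l \<ge> 1\<close> has weight \<open>r\<^sup>l\<^sup>-\<^sup>1\<close>, and \<open>1 + x + r x\<^sup>2 + r\<^sup>2 x\<^sup>3 + \<dots>\<close> gives an upper
  bound (\<open>ex_pmf_shelf_shuffle_le\<close>).

  The two generating functions differ only from the third order on, and for \<open>m\<close> of order \<open>n\<^sup>2\<close> three cards on one
  shelf do not matter. In both bounds, let \<open>k\<close> be the number of cards minus the number of occupied shelves. The
  \<open>k\<close>-th term is close to \<open>exp (- n\<^sup>2 / (2 m)) * (r n\<^sup>2 / m)\<^sup>k / k!\<close>: the first factor is the birthday probability
  that all cards land on distinct shelves, and the second one weighs \<open>k\<close> collisions. As \<open>n\<^sup>2 / m\<close> tends to \<open>1 / c\<close>,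
  the sum over \<open>k\<close> tends to \<open>exp (- 1 / (2 c) + r / c)\<close>, which is the claimed value.
\<close>

section \<open>The law of the piles\<close>

text \<open>
  The probability that the cards of the final pile \<open>f\<close> with labels at most \<open>k\<close>, thrown in decreasing
  order onto a pile that starts as \<open>b\<close>, turn it into \<open>f\<close>, once it is known which shelf each card goes to.
  The cards for this shelf are read off from the target \<open>f\<close> rather than passed separately: for a given
  final configuration they are determined, so the law of the piles becomes a product over the shelves.
\<close>
primrec pile_weight :: "real \<Rightarrow> nat \<Rightarrow> nat list \<Rightarrow> nat list \<Rightarrow> real" where
  "pile_weight p 0 b f = of_bool (b = f)"
| "pile_weight p (Suc k) b f =
     (if Suc k \<in> set f
      then p * pile_weight p k (Suc k # b) f + (1 - p) * pile_weight p k (b @ [Suc k]) f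
      else pile_weight p k b f)"

lemma pile_weight_nonneg:
  assumes "0 \<le> p" "p \<le> 1"
  shows "pile_weight p k b f \<ge> 0"
  using assms by (induction k arbitrary: b) auto

lemma pile_weight_eq_0:
  assumes "\<not> set b \<subseteq> set f"
  shows "pile_weight p k b f = 0"
  using assms by (induction k arbitrary: b) auto

text \<open>
  Turning every pile upside down exchanges top and bottom, hence \<open>p\<close> and \<open>1 - p\<close>. All statements about
  descending piles follow from those about ascending piles in this way.
\<close>
lemma pile_weight_rev: "pile_weight p k (rev b) (rev f) = pile_weight (1 - p) k b f"
proof (induction k arbitrary: b)
  case (Suc k)
  from Suc.IH[of "Suc k # b"] Suc.IH[of "b @ [Suc k]"] Suc.IH[of b]
  show ?case by simp
qed simp

lemma pmf_deal_cards_Suc: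
  assumes "m > 0" "0 \<le> p" "p \<le> 1"
  shows "pmf (deal_cards m p (Suc k) g) f =
    (\<Sum>s\<in>{1..m}. p * pmf (deal_cards m p k (g(s := Suc k # g s))) f +
       (1 - p) * pmf (deal_cards m p k (g(s := g s @ [Suc k]))) f) / real m"
proof -
  have "deal_cards m p (Suc k) g =
    bind_pmf (pmf_of_set {1..m}) (\<lambda>s. bind_pmf (bernoulli_pmf p)
      (\<lambda>b. deal_cards m p k (place_card (Suc k) (s, b) g)))"
    by (simp add: pair_pmf_def bind_assoc_pmf bind_return_pmf)
  then show ?thesis
    using assms by (simp add: pmf_bind integral_pmf_of_set place_card_def mult.commute)
qed

text \<open>
  Every card lies on exactly one pile of the target \<open>f\<close>, so of the \<open>m\<close> shelves that it may be assigned to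
  only one can lead to \<open>f\<close>. This contributes a factor \<open>1 / m\<close> per card and leaves independent choices of
  top or bottom on the separate shelves.
\<close>
lemma pmf_deal_cards:
  assumes "m > 0" "0 \<le> p" "p \<le> 1"
    and "\<And>x. x \<in> {1..k} \<Longrightarrow> \<exists>!s. s \<in> {1..m} \<and> x \<in> set (f s)"
    and "\<And>s. s \<notin> {1..m} \<Longrightarrow> f s = g s"
  shows "pmf (deal_cards m p k g) f = (\<Prod>s\<in>{1..m}. pile_weight p k (g s) (f s)) / real m ^ k"
  using assms(4,5)
proof (induction k arbitrary: g)
  case 0
  have "(\<forall>s\<in>{1..m}. g s = f s) \<longleftrightarrow> g = f"
    using 0(2) by (metis ext)
  then show ?case
    by (cases "g = f") (auto simp: indicator_def)
next
  case (Suc k)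
  obtain t where t: "t \<in> {1..m}" "Suc k \<in> set (f t)"
    and only: "\<And>s. s \<in> {1..m} \<Longrightarrow> Suc k \<in> set (f s) \<Longrightarrow> s = t"
    using Suc.prems(1)[of "Suc k"] by auto
  have IH: "pmf (deal_cards m p k (g(s := b))) f =
      (\<Prod>i\<in>{1..m}. pile_weight p k ((g(s := b)) i) (f i)) / real m ^ k"
    if "s \<in> {1..m}" for s b
    by (rule Suc.IH) (use Suc.prems that in auto)
  have 0: "pmf (deal_cards m p k (g(s := b))) f = 0"
    if "s \<in> {1..m}" "s \<noteq> t" "Suc k \<in> set b" for s b
  proof -
    have "(\<Prod>i\<in>{1..m}. pile_weight p k ((g(s := b)) i) (f i)) = 0"
      by (rule prod_zero) (use that only in \<open>auto intro!: bexI[of _ s] pile_weight_eq_0\<close>)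
    then show ?thesis
      by (simp only: IH[OF that(1)] div_0)
  qed
  \<comment> \<open>\<open>R\<close> collects the piles that do not receive the card \<open>Suc k\<close>; their weights do not change.\<close>
  define R where "R = (\<Prod>i\<in>{1..m} - {t}. pile_weight p (Suc k) (g i) (f i))"
  have 1: "(\<Prod>i\<in>{1..m}. pile_weight p k ((g(t := b)) i) (f i)) =
      pile_weight p k b (f t) * R" for b
  proof -
    have "(\<Prod>i\<in>{1..m} - {t}. pile_weight p k ((g(t := b)) i) (f i)) = R"
      unfolding R_def by (rule prod.cong) (use only in auto)
    then show ?thesis
      using t by (subst prod.remove[of _ t]) auto
  qed
  have "pmf (deal_cards m p (Suc k) g) f =
    (\<Sum>s\<in>{1..m}. if s = t then p * pmf (deal_cards m p k (g(t := Suc k # g t))) f +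
       (1 - p) * pmf (deal_cards m p k (g(t := g t @ [Suc k]))) f else 0) / real m"
    unfolding pmf_deal_cards_Suc[OF assms(1-3)]
    by (intro arg_cong2[where f = "(/)"] sum.cong refl) (simp add: 0)
  also have "\<dots> = (p * pmf (deal_cards m p k (g(t := Suc k # g t))) f +
       (1 - p) * pmf (deal_cards m p k (g(t := g t @ [Suc k]))) f) / real m"
    using t by simp
  also have "\<dots> = pile_weight p (Suc k) (g t) (f t) * R / real m ^ Suc k"
    unfolding IH[OF t(1)] 1 using t(2) \<open>m > 0\<close> by (simp add: field_simps)
  also have "\<dots> = (\<Prod>i\<in>{1..m}. pile_weight p (Suc k) (g i) (f i)) / real m ^ Suc k"
    unfolding R_def using t(1) by (subst (2) prod.remove[of _ t]) simp_all
  finally show ?case .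
qed

section \<open>The probability of a deck as a sum over its splits\<close>

text \<open>
  The final piles that produce the deck \<open>xs\<close>, as a list of \<open>m\<close> possibly empty consecutive blocks.
\<close>
definition splits :: "nat \<Rightarrow> 'a list \<Rightarrow> 'a list list set" where
  "splits m xs = {bs. length bs = m \<and> concat bs = xs}"

lemma splits_0: "splits 0 xs = (if xs = [] then {[]} else {})"
  by (auto simp: splits_def)

lemma splits_Suc:
  "splits (Suc m) xs = (\<lambda>(i, bs). take i xs # bs) ` (SIGMA i:{..length xs}. splits m (drop i xs))"
proof (intro equalityI subsetI)
  fix cs assume "cs \<in> splits (Suc m) xs"
  then obtain b bs where "cs = b # bs" "length bs = m" "xs = b @ concat bs"
    by (auto simp: splits_def length_Suc_conv)
  then show "cs \<in> (\<lambda>(i, bs). take i xs # bs) ` (SIGMA i:{..length xs}. splits m (drop i xs))"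
    by (intro image_eqI[of _ _ "(length b, bs)"]) (auto simp: splits_def)
qed (auto simp: splits_def)

lemma finite_splits: "finite (splits m xs)"
  by (induction m arbitrary: xs) (auto simp: splits_0 splits_Suc)

text \<open>
  For weights that depend only on the block lengths, cutting off the first block is the Cauchy product,
  so the sum over all splits is a coefficient of the \<open>m\<close>-th power of the generating function.
\<close>
lemma sum_splits_fps:
  fixes G :: "real fps"
  shows "(\<Sum>bs\<in>splits m xs. \<Prod>b\<leftarrow>bs. fps_nth G (length b)) = fps_nth (G ^ m) (length xs)"
proof (induction m arbitrary: xs)
  case 0
  show ?case by (simp add: splits_0)
next
  case (Suc m)
  have inj: "inj_on (\<lambda>(i, bs). take i xs # bs) (SIGMA i:{..length xs}. splits m (drop i xs))"
    by (auto simp: inj_on_def dest: arg_cong[where f = length])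
  have "(\<Sum>bs\<in>splits (Suc m) xs. \<Prod>b\<leftarrow>bs. fps_nth G (length b)) =
      (\<Sum>(i, bs)\<in>(SIGMA i:{..length xs}. splits m (drop i xs)). fps_nth G i * (\<Prod>b\<leftarrow>bs. fps_nth G (length b)))"
    unfolding splits_Suc by (subst sum.reindex[OF inj]) (auto intro!: sum.cong)
  also have "\<dots> = (\<Sum>i\<in>{..length xs}. \<Sum>bs\<in>splits m (drop i xs). fps_nth G i * (\<Prod>b\<leftarrow>bs. fps_nth G (length b)))"
    by (rule sum.Sigma[symmetric]) (auto simp: finite_splits)
  also have "\<dots> = (\<Sum>i\<in>{..length xs}. fps_nth G i * fps_nth (G ^ m) (length xs - i))"
    by (simp add: sum_distrib_left[symmetric] Suc.IH)
  also have "\<dots> = fps_nth (G ^ Suc m) (length xs)"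
    by (simp add: fps_mult_nth atLeast0AtMost)
  finally show ?case .
qed

lemma distinct_concat_nth_eq:
  assumes "distinct (concat bs)" "i < length bs" "j < length bs" "x \<in> set (bs ! i)" "x \<in> set (bs ! j)"
  shows "i = j"
  using assms
proof (induction bs arbitrary: i j)
  case (Cons b bs)
  then show ?case
    by (cases i; cases j) (fastforce simp: disjoint_iff)+
qed simp

text \<open>
  The shelves outside \<open>{1..m}\<close> stay empty, so the configurations of piles that give the deck \<open>xs\<close>
  correspond to its splits.
\<close>
lemma pmf_shelf_shuffle:
  assumes "m > 0" "0 \<le> p" "p \<le> 1" and xs: "xs \<in> permutations_of_set {1..n}"
  shows "pmf (shelf_shuffle n m p) xs =
    (\<Sum>bs\<in>splits m xs. \<Prod>b\<leftarrow>bs. pile_weight p n [] b) / real m ^ n"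
proof -
  define F :: "nat list list \<Rightarrow> nat \<Rightarrow> nat list"
    where "F bs = (\<lambda>s. if s \<in> {1..m} then bs ! (s - 1) else [])" for bs
  define h :: "(nat \<Rightarrow> nat list) \<Rightarrow> nat list"
    where "h = (\<lambda>piles. concat (map piles [1..<Suc m]))"
  let ?D = "deal_cards m p n (\<lambda>_. [])"
  have outside: "piles s = g s"
    if "piles \<in> set_pmf (deal_cards m p k g)" "s \<notin> {1..m}" for piles g s k
    using that(1)
  proof (induction k arbitrary: g)
    case (Suc k)
    then obtain t b where t: "t \<in> {1..m}"
      and "piles \<in> set_pmf (deal_cards m p k (place_card (Suc k) (t, b) g))"
      using assms(1) by (auto simp: set_pmf_of_set)
    from Suc.IH[OF this(2)] t that(2) show ?case
      by (auto simp: place_card_def)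
  qed simp
  have F_nth: "map (F bs) [1..<Suc m] = bs" if "length bs = m" for bs
    using that by (intro nth_equalityI) (auto simp: F_def simp del: upt_Suc)
  have inj: "inj_on F (splits m xs)"
    by (rule inj_onI) (metis (mono_tags, lifting) F_nth mem_Collect_eq splits_def)
  have "h -` {xs} \<inter> set_pmf ?D \<subseteq> F ` splits m xs"
  proof
    fix f assume f: "f \<in> h -` {xs} \<inter> set_pmf ?D"
    then have "f = F (map f [1..<Suc m])"
      using outside[of f n "\<lambda>_. []"] by (auto simp: F_def fun_eq_iff simp del: upt_Suc)
    moreover have "map f [1..<Suc m] \<in> splits m xs"
      using f by (auto simp: splits_def h_def simp del: upt_Suc)
    ultimately show "f \<in> F ` splits m xs" by blast
  qed
  moreover have "F ` splits m xs \<subseteq> h -` {xs}"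
    using F_nth by (force simp: h_def splits_def simp del: upt_Suc One_nat_def)
  ultimately have "measure ?D (h -` {xs}) = measure ?D (F ` splits m xs)"
    by (intro measure_pmf.finite_measure_eq_AE) (auto intro!: AE_pmfI)
  also have "\<dots> = (\<Sum>bs\<in>splits m xs. pmf ?D (F bs))"
    by (simp add: measure_measure_pmf_finite finite_splits sum.reindex[OF inj])
  also have "\<dots> = (\<Sum>bs\<in>splits m xs. (\<Prod>b\<leftarrow>bs. pile_weight p n [] b) / real m ^ n)"
  proof (rule sum.cong)
    fix bs assume "bs \<in> splits m xs"
    then have len: "length bs = m" and cat: "concat bs = xs"
      by (auto simp: splits_def)
    have "\<exists>!s. s \<in> {1..m} \<and> x \<in> set (F bs s)" if x: "x \<in> {1..n}" for x
    proof -
      have "x \<in> set (concat bs)" and dist: "distinct (concat bs)"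
        using xs x cat by (auto simp: permutations_of_set_def)
      then obtain i where i: "i < m" "x \<in> set (bs ! i)"
        using len by (auto simp: in_set_conv_nth[of _ bs])
      show ?thesis
      proof (rule ex1I[of _ "Suc i"])
        show "Suc i \<in> {1..m} \<and> x \<in> set (F bs (Suc i))"
          using i by (simp add: F_def)
      next
        fix s assume s: "s \<in> {1..m} \<and> x \<in> set (F bs s)"
        then have "x \<in> set (bs ! (s - 1))"
          by (simp add: F_def)
        from distinct_concat_nth_eq[OF dist _ _ i(2) this] s i len
        show "s = Suc i" by auto
      qed
    qed
    then have "pmf ?D (F bs) = (\<Prod>s\<in>{1..m}. pile_weight p n [] (F bs s)) / real m ^ n"
      by (intro pmf_deal_cards assms) (auto simp: F_def)
    also have "(\<Prod>s\<in>{1..m}. pile_weight p n [] (F bs s)) =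
        (\<Prod>b\<leftarrow>map (F bs) [1..<Suc m]. pile_weight p n [] b)"
      by (simp add: prod.distinct_set_conv_list[symmetric] atLeastLessThanSuc_atLeastAtMost o_def del: upt_Suc)
    finally show "pmf ?D (F bs) = (\<Prod>b\<leftarrow>bs. pile_weight p n [] b) / real m ^ n"
      by (simp only: F_nth[OF len])
  qed simp
  finally show ?thesis
    by (simp add: shelf_shuffle_def pmf_map h_def sum_divide_distrib del: upt_Suc)
qed

section \<open>Weights of short piles and of monotone piles\<close>

lemma pile_weight_no_card:
  assumes "set f \<inter> {1..k} = {}"
  shows "pile_weight p k b f = of_bool (b = f)"
  using assms by (induction k) (auto simp: atLeastAtMostSuc_conv)

lemma pile_weight_one_card:
  assumes "set f \<inter> {1..k} = {x}"
  shows "pile_weight p k b f = p * of_bool (x # b = f) + (1 - p) * of_bool (b @ [x] = f)"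
  using assms
proof (induction k)
  case (Suc k)
  show ?case
  proof (cases "Suc k \<in> set f")
    case True
    then have "Suc k \<in> set f \<inter> {1..Suc k}"
      by simp
    then have "x = Suc k"
      unfolding Suc.prems by simp
    moreover have "set f \<inter> {1..k} \<subseteq> set f \<inter> {1..Suc k} - {Suc k}"
      by auto
    ultimately have "set f \<inter> {1..k} = {}" "x = Suc k"
      unfolding Suc.prems by simp_all
    then show ?thesis
      using True by (simp add: pile_weight_no_card)
  next
    case False
    then have "set f \<inter> {1..k} = {x}"
      using Suc.prems by (simp add: atLeastAtMostSuc_conv)
    with False Suc.IH show ?thesis by simp
  qed
qed simp

text \<open>
  The larger card \<open>y\<close> starts the pile, wherever it is said to be placed, and \<open>x\<close> has to go on top of it.
\<close>
lemma pile_weight_ascent: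
  assumes "1 \<le> x" "x < y" "y \<le> k"
  shows "pile_weight p k [] [x, y] = p"
  using assms
proof (induction k)
  case (Suc k)
  show ?case
  proof (cases "y = Suc k")
    case True
    have "set [x, y] \<inter> {1..k} = {x}"
      using Suc.prems True by auto
    from pile_weight_one_card[OF this] show ?thesis
      using True Suc.prems by (simp add: algebra_simps)
  qed (use Suc in auto)
qed simp

lemma pile_weight_descent:
  assumes "1 \<le> y" "y < x" "x \<le> k"
  shows "pile_weight p k [] [x, y] = 1 - p"
  using pile_weight_rev[of "1 - p" k "[]" "[y, x]"] pile_weight_ascent[OF assms, of "1 - p"]
    pile_weight_rev[of p k "[]" "[y, x]"]
  by simp

text \<open>
  Among the piles with at most two cards, the empty pile and a single card have weight 1 and a pair has
  weight \<open>p\<close> or \<open>1 - p\<close>. Longer piles may have weight 0, and the minorant gives them weight 0.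
\<close>
lemma pile_weight_ge:
  assumes "0 \<le> r" "r \<le> p" "r \<le> 1 - p" "distinct b" "set b \<subseteq> {1..k}"
  shows "fps_nth (1 + fps_X * (1 + fps_const r * fps_X)) (length b) \<le> pile_weight p k [] b"
proof -
  have nth: "fps_nth (1 + fps_X * (1 + fps_const r * fps_X)) i =
      (if i < 2 then 1 else if i = 2 then r else 0)" for i
    by (cases i) (auto simp: numeral_2_eq_2 fps_X_mult_nth)
  consider "b = []" | x where "b = [x]" | x y where "b = [x, y]" | "length b > 2"
    by (cases b; cases "tl b"; cases "tl (tl b)") auto
  then show ?thesis
  proof cases
    case 1
    then show ?thesis by (simp add: pile_weight_no_card)
  next
    case (2 x)
    then have "set b \<inter> {1..k} = {x}" using assms by auto
    from pile_weight_one_card[OF this] show ?thesis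
      by (simp add: 2 nth)
  next
    case (3 x y)
    then have "x < y \<or> y < x" using assms by auto
    then show ?thesis
      using pile_weight_ascent[of x y k p] pile_weight_descent[of y x k p] assms 3
      by (auto simp: nth)
  next
    case 4
    then show ?thesis
      using pile_weight_nonneg[of p k "[]" b] assms by (auto simp: nth)
  qed
qed

text \<open>
  A pile only grows at its ends, so what lies on a shelf stays together.
\<close>
lemma sublist_if_pile_weight_nz:
  assumes "pile_weight p k b f \<noteq> 0"
  shows "sublist b f"
  using assms
proof (induction k arbitrary: b)
  case 0
  then show ?case by (auto split: if_splits)
next
  case (Suc k)
  have "pile_weight p k (Suc k # b) f \<noteq> 0 \<or> pile_weight p k (b @ [Suc k]) f \<noteq> 0 \<or> pile_weight p k b f \<noteq> 0"
    using Suc.prems by (auto split: if_splits)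
  then have "sublist (Suc k # b) f \<or> sublist (b @ [Suc k]) f \<or> sublist b f"
    using Suc.IH by blast
  moreover have "sublist b (Suc k # b)" "sublist b (b @ [Suc k])"
    by (auto intro: suffix_imp_sublist prefix_imp_sublist suffix_ConsI)
  ultimately show ?case
    by (meson sublist_order.order_trans)
qed

lemma sorted_wrt_sublist: "sublist b f \<Longrightarrow> sorted_wrt P f \<Longrightarrow> sorted_wrt P b"
  by (auto simp: sublist_def sorted_wrt_append)

text \<open>
  In an ascending pile no card may go below a card that was dealt earlier, since that card is larger.
  Hence each card after the first must go on top, at the price of a factor \<open>p\<close>.
\<close>
lemma pile_weight_sorted_nonempty_le:
  assumes "0 \<le> p" "p \<le> 1" "sorted_wrt (<) f" "b \<noteq> []" "\<And>x. x \<in> set b \<Longrightarrow> k < x"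
  shows "pile_weight p k b f \<le> p ^ (length f - length b)"
  using assms(4,5)
proof (induction k arbitrary: b)
  case 0
  then show ?case using assms by auto
next
  case (Suc k)
  show ?case
  proof (cases "Suc k \<in> set f")
    case True
    have "\<not> sorted_wrt (<) (b @ [Suc k])"
      using Suc.prems by (cases b) (fastforce simp: sorted_wrt_append)+
    then have bottom: "pile_weight p k (b @ [Suc k]) f = 0"
      using sublist_if_pile_weight_nz sorted_wrt_sublist assms(3) by blast
    show ?thesis
    proof (cases "length b < length f")
      case True
      have "pile_weight p k (Suc k # b) f \<le> p ^ (length f - length (Suc k # b))"
        by (rule Suc.IH) (use Suc.prems in \<open>auto dest: Suc_lessD\<close>)
      then have "p * pile_weight p k (Suc k # b) f \<le> p * p ^ (length f - Suc (length b))"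
        using assms by (intro mult_left_mono) auto
      also have "\<dots> = p ^ (length f - length b)"
        using True by (metis Suc_diff_Suc power_Suc)
      finally show ?thesis
        using \<open>Suc k \<in> set f\<close> bottom by simp
    next
      case False
      then have "pile_weight p k (Suc k # b) f = 0"
        using sublist_if_pile_weight_nz[of p k "Suc k # b" f] sublist_length_le by fastforce
      then show ?thesis
        using bottom assms \<open>Suc k \<in> set f\<close> by simp
    qed
  next
    case False
    have "pile_weight p k b f \<le> p ^ (length f - length b)"
      by (rule Suc.IH) (use Suc.prems in \<open>auto dest: Suc_lessD\<close>)
    with False show ?thesis by simp
  qed
qed

text \<open>
  The first card of a pile costs nothing, whichever end it is assigned to. This explains the exponent, one
  less than the number of cards.
\<close>
lemma pile_weight_sorted_le:
  assumes "0 \<le> p" "p \<le> 1" "sorted_wrt (<) f"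
  shows "pile_weight p k [] f \<le> fps_nth (1 + fps_X * Abs_fps (\<lambda>i. p ^ i)) (length f)"
proof (cases f)
  case Nil
  then show ?thesis by (simp add: pile_weight_no_card)
next
  case (Cons x xs)
  have "pile_weight p k [] f \<le> p ^ (length f - 1)"
  proof (induction k)
    case 0
    then show ?case using Cons assms by simp
  next
    case (Suc k)
    show ?case
    proof (cases "Suc k \<in> set f")
      case True
      then have "pile_weight p (Suc k) [] f = pile_weight p k [Suc k] f"
        by (simp add: algebra_simps)
      also have "\<dots> \<le> p ^ (length f - length [Suc k])"
        by (rule pile_weight_sorted_nonempty_le) (use assms in auto)
      finally show ?thesis by simp
    qed (use Suc in simp)
  qed
  then show ?thesis by (simp add: Cons)
qed

section \<open>Bounds for the probability of a deck\<close>

lemma prod_list_mono: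
  fixes f g :: "'a \<Rightarrow> real"
  assumes "\<And>x. x \<in> set xs \<Longrightarrow> 0 \<le> f x" "\<And>x. x \<in> set xs \<Longrightarrow> f x \<le> g x"
  shows "(\<Prod>x\<leftarrow>xs. f x) \<le> (\<Prod>x\<leftarrow>xs. g x)"
  using assms
proof (induction xs)
  case (Cons x xs)
  then show ?case
    by (auto intro!: mult_mono prod_list_nonneg intro: order_trans)
qed simp

lemma sublist_if_in_splits:
  assumes "bs \<in> splits m xs" "b \<in> set bs"
  shows "sublist b xs"
proof -
  from assms(2) obtain us vs where "bs = us @ b # vs"
    by (auto simp: in_set_conv_decomp)
  with assms(1) have "xs = concat us @ b @ concat vs"
    by (auto simp: splits_def)
  then show ?thesis by (auto simp: sublist_def)
qed

lemma sum_splits_mono: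
  fixes v w :: "'a list \<Rightarrow> real"
  assumes "\<And>b. sublist b xs \<Longrightarrow> 0 \<le> v b" "\<And>b. sublist b xs \<Longrightarrow> v b \<le> w b"
  shows "(\<Sum>bs\<in>splits m xs. \<Prod>b\<leftarrow>bs. v b) \<le> (\<Sum>bs\<in>splits m xs. \<Prod>b\<leftarrow>bs. w b)"
  by (intro sum_mono prod_list_mono) (use assms sublist_if_in_splits in blast)+

lemma length_permutation: "xs \<in> permutations_of_set {1..n} \<Longrightarrow> length xs = n"
  using length_finite_permutations_of_set by fastforce

lemma pmf_shelf_shuffle_ge:
  assumes "m > 0" "0 \<le> r" "r \<le> p" "r \<le> 1 - p" and xs: "xs \<in> permutations_of_set {1..n}"
  shows "fps_nth ((1 + fps_X * (1 + fps_const r * fps_X)) ^ m) n / real m ^ n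
    \<le> pmf (shelf_shuffle n m p) xs"
proof -
  let ?G = "1 + fps_X * (1 + fps_const r * fps_X)"
  have "fps_nth (?G ^ m) n = (\<Sum>bs\<in>splits m xs. \<Prod>b\<leftarrow>bs. fps_nth ?G (length b))"
    by (simp only: sum_splits_fps length_permutation[OF xs])
  also have "\<dots> \<le> (\<Sum>bs\<in>splits m xs. \<Prod>b\<leftarrow>bs. pile_weight p n [] b)"
  proof (rule sum_splits_mono)
    fix b assume "sublist b xs"
    then obtain us vs where "xs = us @ b @ vs"
      by (auto simp: sublist_def)
    moreover have "distinct xs" "set xs = {1..n}"
      using xs by (simp_all add: permutations_of_set_def)
    ultimately have "distinct b" "set b \<subseteq> {1..n}"
      by auto
    with assms(2-4) show "fps_nth ?G (length b) \<le> pile_weight p n [] b"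
      by (rule pile_weight_ge)
    show "0 \<le> fps_nth ?G (length b)"
      using \<open>0 \<le> r\<close> by (cases "length b") (simp_all add: fps_X_mult_nth)
  qed
  finally show ?thesis
    using assms by (simp add: pmf_shelf_shuffle divide_right_mono)
qed

lemma pmf_shelf_shuffle_le:
  assumes "m > 0" "0 \<le> p" "p \<le> 1" and xs: "xs \<in> permutations_of_set {1..n}"
    and le: "\<And>b. sublist b xs \<Longrightarrow>
      pile_weight p n [] b \<le> fps_nth (1 + fps_X * Abs_fps (\<lambda>i. r ^ i)) (length b)"
  shows "pmf (shelf_shuffle n m p) xs
    \<le> fps_nth ((1 + fps_X * Abs_fps (\<lambda>i. r ^ i)) ^ m) n / real m ^ n"
proof -
  let ?G = "1 + fps_X * Abs_fps (\<lambda>i. r ^ i)"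
  have "(\<Sum>bs\<in>splits m xs. \<Prod>b\<leftarrow>bs. pile_weight p n [] b)
      \<le> (\<Sum>bs\<in>splits m xs. \<Prod>b\<leftarrow>bs. fps_nth ?G (length b))"
    by (rule sum_splits_mono) (use le assms pile_weight_nonneg in auto)
  also have "\<dots> = fps_nth (?G ^ m) n"
    by (simp only: sum_splits_fps length_permutation[OF xs])
  finally show ?thesis
    using assms by (simp add: pmf_shelf_shuffle divide_right_mono)
qed

text \<open>
  The unlikely deck: placing on the likelier side is useless except for the first card of each pile.
  It is the increasing deck if \<open>p \<le> 1/2\<close> and the decreasing deck otherwise.
\<close>
lemma ex_pmf_shelf_shuffle_le:
  assumes "m > 0" "0 \<le> p" "p \<le> 1"
  shows "\<exists>xs\<in>permutations_of_set {1..n}. pmf (shelf_shuffle n m p) xs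
    \<le> fps_nth ((1 + fps_X * Abs_fps (\<lambda>i. min p (1 - p) ^ i)) ^ m) n / real m ^ n"
proof -
  define xs where "xs = [1..<Suc n]"
  have sorted: "sorted_wrt (<) xs"
    unfolding xs_def by (rule sorted_wrt_upt)
  have xs: "xs \<in> permutations_of_set {1..n}"
    unfolding xs_def by (rule permutations_of_setI) auto
  show ?thesis
  proof (cases "p \<le> 1 / 2")
    case True
    then have "min p (1 - p) = p" by simp
    with xs show ?thesis
      by (intro bexI[of _ xs] pmf_shelf_shuffle_le)
        (use assms sorted_wrt_sublist[OF _ sorted] pile_weight_sorted_le in auto)
  next
    case False
    then have min: "min p (1 - p) = 1 - p" by simp
    have rev: "rev xs \<in> permutations_of_set {1..n}"
      using xs by (auto simp: permutations_of_set_def)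
    show ?thesis
    proof (rule bexI[OF _ rev], unfold min, rule pmf_shelf_shuffle_le[OF assms rev])
      fix b assume "sublist b (rev xs)"
      then have "sorted_wrt (<) (rev b)"
        using sorted_wrt_sublist[OF _ sorted] by (metis rev_rev_ident sublist_rev)
      from pile_weight_sorted_le[OF _ _ this, of "1 - p" n] pile_weight_rev[of "1 - p" n "[]" b]
      show "pile_weight p n [] b \<le> fps_nth (1 + fps_X * Abs_fps (\<lambda>i. (1 - p) ^ i)) (length b)"
        using assms by simp
    qed
  qed
qed

section \<open>Coefficients of the generating functions\<close>

text \<open>
  Here \<open>x * H\<close> is the generating function of the nonempty blocks. The summation index is the number of cards
  minus the number of nonempty blocks, which stays bounded in the relevant range.
\<close>
lemma fps_nth_power_one_plus_X_mult:
  fixes H :: "real fps"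
  shows "fps_nth ((1 + fps_X * H) ^ m) n =
    (\<Sum>k\<le>n. real (m choose (n - k)) * fps_nth (H ^ (n - k)) k)"
proof -
  have "(1 + fps_X * H) ^ m = (\<Sum>j\<le>m. of_nat (m choose j) * (fps_X ^ j * H ^ j))"
    using binomial_ring[of "fps_X * H" 1 m] by (simp add: add.commute power_mult_distrib mult.assoc)
  then have "fps_nth ((1 + fps_X * H) ^ m) n =
      (\<Sum>j\<le>m. real (m choose j) * fps_nth (fps_X ^ j * H ^ j) n)"
    by (simp add: fps_sum_nth fps_of_nat[symmetric])
  also have "\<dots> = (\<Sum>j\<le>m. if j \<le> n then real (m choose j) * fps_nth (H ^ j) (n - j) else 0)"
    by (intro sum.cong) (auto simp: fps_X_power_mult_nth)
  also have "\<dots> = (\<Sum>j\<in>{..n}. real (m choose j) * fps_nth (H ^ j) (n - j))"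
    by (intro sum.mono_neutral_cong) auto
  also have "\<dots> = (\<Sum>k\<le>n. real (m choose (n - k)) * fps_nth (H ^ (n - k)) k)"
    by (rule sum.reindex_bij_witness[of _ "\<lambda>k. n - k" "\<lambda>j. n - j"]) auto
  finally show ?thesis .
qed

lemma fps_nth_power_linear:
  "fps_nth ((1 + fps_const r * fps_X) ^ j) k = real (j choose k) * (r :: real) ^ k"
proof -
  have "(1 + fps_const r * fps_X) ^ j = (\<Sum>i\<le>j. of_nat (j choose i) * (fps_const (r ^ i) * fps_X ^ i))"
    using binomial_ring[of "fps_const r * fps_X" 1 j]
    by (simp add: add.commute power_mult_distrib mult.assoc flip: fps_const_power)
  then have "fps_nth ((1 + fps_const r * fps_X) ^ j) k =
      (\<Sum>i\<le>j. real (j choose i) * (r ^ i * (if k = i then 1 else 0)))"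
    by (simp add: fps_sum_nth fps_of_nat[symmetric] fps_X_power_nth)
  also have "\<dots> = (\<Sum>i\<le>j. if i = k then real (j choose i) * r ^ i else 0)"
    by (intro sum.cong) auto
  finally show ?thesis by simp
qed

lemma fps_nth_power_geometric:
  assumes "j > 0"
  shows "fps_nth (Abs_fps (\<lambda>i. r ^ i) ^ j) k = real (j + k - 1 choose k) * (r :: real) ^ k"
proof -
  have "Abs_fps (\<lambda>i. r ^ i) = inverse ((1 - fps_const r * fps_X) ^ 1)"
    by (subst one_minus_const_fps_X_neg_power') (auto simp: fps_eq_iff)
  then have "Abs_fps (\<lambda>i. r ^ i) ^ j = inverse ((1 - fps_const r * fps_X) ^ j)"
    by (simp add: fps_inverse_power)
  then show ?thesis
    by (simp add: one_minus_const_fps_X_neg_power'[OF assms])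
qed

section \<open>Birthday estimates\<close>

text \<open>
  The birthday probability: \<open>j\<close> cards thrown on \<open>m\<close> shelves land on distinct shelves.
\<close>
definition no_collision :: "nat \<Rightarrow> nat \<Rightarrow> real" where
  "no_collision m j = (\<Prod>i<j. 1 - real i / real m)"

lemma choose_eq_no_collision:
  assumes "m > 0"
  shows "real (m choose j) = no_collision m j * real m ^ j / fact j"
proof -
  have "real (m choose j) * fact j = (\<Prod>i<j. real m - real i)"
    using gbinomial_mult_fact'[of "real m" j]
    by (simp add: binomial_gbinomial atLeast0LessThan)
  also have "\<dots> = (\<Prod>i<j. (1 - real i / real m) * real m)"
    using assms by (intro prod.cong) (auto simp: field_simps)
  also have "\<dots> = no_collision m j * real m ^ j"
    by (simp add: no_collision_def prod.distrib)
  finally show ?thesis by (simp add: field_simps)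
qed

lemma sum_upto: "(\<Sum>i<j. real i) = real j * (real j - 1) / 2"
  by (induction j) (auto simp: field_simps)

text \<open>
  The inequality \<open>1 - x \<le> exp (- x)\<close> needs nonnegative factors to be multiplied; if \<open>j > m\<close>, then a factor vanishes.
\<close>
lemma no_collision_le:
  assumes "m > 0"
  shows "no_collision m j \<le> exp (- (real j * (real j - 1) / (2 * real m)))"
proof (cases "j \<le> m")
  case True
  have "no_collision m j \<le> (\<Prod>i<j. exp (- (real i / real m)))"
    unfolding no_collision_def
  proof (rule prod_mono)
    fix i assume "i \<in> {..<j}"
    then have "0 \<le> 1 - real i / real m"
      using True assms by (simp add: field_simps)
    then show "0 \<le> 1 - real i / real m \<and> 1 - real i / real m \<le> exp (- (real i / real m))"
      using exp_ge_add_one_self[of "- (real i / real m)"] by simp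
  qed
  also have "\<dots> = exp (- ((\<Sum>i<j. real i) / real m))"
    by (simp add: exp_sum[symmetric] sum_negf sum_divide_distrib)
  finally show ?thesis
    by (simp add: sum_upto)
next
  case False
  then have "no_collision m j = 0"
    unfolding no_collision_def using assms by (intro prod_zero) (auto intro!: bexI[of _ m])
  then show ?thesis by simp
qed

text \<open>
  The estimate \<open>1 / (1 - x) = 1 + x / (1 - x) \<le> exp (x / (1 - x))\<close> for each factor.
\<close>
lemma no_collision_ge:
  assumes "j < m"
  shows "exp (- (real j ^ 2 / (2 * (real m - real j)))) \<le> no_collision m j"
proof -
  let ?d = "real m - real j"
  have d: "?d > 0" using assms by simp
  have "(\<Sum>i<j. real i) \<le> real j ^ 2 / 2"
    by (simp add: sum_upto power2_eq_square field_simps)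
  then have "(\<Sum>i<j. real i) / ?d \<le> real j ^ 2 / 2 / ?d"
    using d by (intro divide_right_mono) auto
  then have "exp (- (real j ^ 2 / (2 * ?d))) \<le> exp (- ((\<Sum>i<j. real i) / ?d))"
    by simp
  also have "\<dots> = (\<Prod>i<j. exp (- (real i / ?d)))"
    by (simp add: exp_sum[symmetric] sum_negf sum_divide_distrib)
  also have "\<dots> \<le> no_collision m j"
    unfolding no_collision_def
  proof (rule prod_mono)
    fix i assume "i \<in> {..<j}"
    then have i: "i < j" by simp
    have "inverse (1 - real i / real m) = 1 + real i / (real m - real i)"
      using i assms by (simp add: field_simps)
    also have "\<dots> \<le> 1 + real i / ?d"
      using i d by (intro add_left_mono divide_left_mono) auto
    also have "\<dots> \<le> exp (real i / ?d)"
      by (rule exp_ge_add_one_self)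
    finally have "exp (- (real i / ?d)) \<le> 1 - real i / real m"
      using i assms by (simp add: exp_minus field_simps)
    then show "0 \<le> exp (- (real i / ?d)) \<and> exp (- (real i / ?d)) \<le> 1 - real i / real m"
      by simp
  qed
  finally show ?thesis .
qed

lemma power_mult_fact_le: "real a ^ b * fact a \<le> fact (a + b)"
proof (induction b)
  case (Suc b)
  have "real a ^ Suc b * fact a \<le> real a * fact (a + b)"
    using mult_left_mono[OF Suc, of "real a"] by (simp add: mult_ac)
  also have "\<dots> \<le> real (Suc (a + b)) * fact (a + b)"
    by (intro mult_right_mono) auto
  finally show ?case by simp
qed simp

text \<open>
  The term with \<open>k\<close> colliding pairs. The factor \<open>n! / (n - 2k)!\<close> is about \<open>n\<^sup>2\<^sup>k\<close>, so the term is about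
  \<open>(r * n\<^sup>2 / m)\<^sup>k / k!\<close> times the probability of no collision.
\<close>
lemma birthday_coeff_ge:
  assumes "0 \<le> r" "2 * k \<le> n" "n < m"
  shows "exp (- (real n ^ 2 / (2 * (real m - real n)))) * ((r * (real n - 2 * real k) ^ 2 / real m) ^ k / fact k)
    \<le> fact n / real m ^ n * (real (m choose (n - k)) * (real (n - k choose k) * r ^ k))"
proof -
  define a where "a = n - 2 * k"
  have n: "n = a + 2 * k" using assms by (simp add: a_def)
  have m: "m > 0" using assms by simp
  have "real (n - k) ^ 2 / (2 * (real m - real (n - k))) \<le> real n ^ 2 / (2 * (real m - real n))"
    using assms by (intro frac_le power_mono) auto
  then have nc: "exp (- (real n ^ 2 / (2 * (real m - real n)))) \<le> no_collision m (n - k)"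
    using no_collision_ge[of "n - k" m] assms by (smt (verit) exp_le_cancel_iff less_imp_diff_less)
  have "(real a ^ 2) ^ k \<le> fact n / fact a"
    using power_mult_fact_le[of a "2 * k"] unfolding n power_mult by (simp add: pos_le_divide_eq)
  then have "(r / real m) ^ k * ((real a ^ 2) ^ k / fact k) \<le> (r / real m) ^ k * (fact n / fact a / fact k)"
    using assms by (intro mult_left_mono divide_right_mono) auto
  then have "(r * real a ^ 2 / real m) ^ k / fact k \<le> (r / real m) ^ k * (fact n / (fact k * fact a))"
    by (simp add: power_mult_distrib power_divide field_simps)
  then have "exp (- (real n ^ 2 / (2 * (real m - real n)))) * ((r * real a ^ 2 / real m) ^ k / fact k)
      \<le> no_collision m (n - k) * ((r / real m) ^ k * (fact n / (fact k * fact a)))"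
    using nc assms by (intro mult_mono) (auto intro: order_trans[OF exp_ge_zero])
  also have "\<dots> = fact n / real m ^ n * (real (m choose (n - k)) * (real (n - k choose k) * r ^ k))"
  proof -
    have "real (n - k choose k) = fact (n - k) / (fact k * fact a)"
      using binomial_fact[of k "n - k", where ?'a = real] by (simp add: n)
    moreover have "real m ^ n = real m ^ (n - k) * real m ^ k"
      using assms by (simp flip: power_add)
    ultimately show ?thesis
      using m by (simp add: choose_eq_no_collision power_divide field_simps)
  qed
  finally show ?thesis
    by (simp add: n)
qed

text \<open>
  Only the first \<open>K\<close> terms are kept: for fixed \<open>K\<close> the bound is a finite sum, and its limit can be taken
  term by term.
\<close>
lemma normalised_linear_coeff_ge:
  assumes "0 \<le> r" "2 * K \<le> n" "n < m"
  shows "exp (- (real n ^ 2 / (2 * (real m - real n)))) *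
      (\<Sum>k<K. (r * (real n - 2 * real k) ^ 2 / real m) ^ k / fact k)
    \<le> fact n * (fps_nth ((1 + fps_X * (1 + fps_const r * fps_X)) ^ m) n / real m ^ n)"
proof -
  have "exp (- (real n ^ 2 / (2 * (real m - real n)))) *
      (\<Sum>k<K. (r * (real n - 2 * real k) ^ 2 / real m) ^ k / fact k)
    \<le> (\<Sum>k<K. fact n / real m ^ n * (real (m choose (n - k)) * (real (n - k choose k) * r ^ k)))"
    unfolding sum_distrib_left by (intro sum_mono birthday_coeff_ge) (use assms in auto)
  also have "\<dots> \<le> (\<Sum>k\<le>n. fact n / real m ^ n * (real (m choose (n - k)) * (real (n - k choose k) * r ^ k)))"
    by (intro sum_mono2) (use assms in auto)
  finally show ?thesis
    by (simp add: fps_nth_power_one_plus_X_mult fps_nth_power_linear sum_distrib_left sum_divide_distrib)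
qed

lemma sum_exp_le:
  fixes y :: real
  assumes "0 \<le> y"
  shows "(\<Sum>k\<le>n. y ^ k / fact k) \<le> exp y"
proof -
  have "(\<Sum>k\<le>n. y ^ k / fact k) \<le> (\<Sum>k. y ^ k / fact k)"
    using summable_exp[of y] assms
    by (intro sum_le_suminf) (auto simp: field_simps)
  then show ?thesis
    by (simp add: exp_def field_simps)
qed

text \<open>
  Passing from \<open>n - k\<close> to \<open>n\<close> occupied shelves in the birthday probability costs at most a factor
  \<open>exp (n / m)\<close> for each of the \<open>k\<close> cards, because \<open>(n - k) (n - k - 1) \<ge> n (n - 1) - 2 n k\<close>. The bound is uniform
  in \<open>k\<close>, so that the terms can be summed to an exponential before the limit is taken.
\<close>
lemma birthday_coeff_le:
  assumes "0 \<le> r" "k < n" "m > 0"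
  shows "fact n / real m ^ n * (real (m choose (n - k)) * (real (n - 1 choose k) * r ^ k))
    \<le> exp (- (real n * (real n - 1) / (2 * real m))) *
      ((r * real n ^ 2 / real m * exp (real n / real m)) ^ k / fact k)"
proof -
  define j where "j = n - k"
  have n: "n = j + k" using assms by (simp add: j_def)
  have "real n * (real n - 1) - 2 * real n * real k \<le> real j * (real j - 1)"
    unfolding n by (simp add: algebra_simps)
  then have "(real n * (real n - 1) - 2 * real n * real k) / (2 * real m)
      \<le> real j * (real j - 1) / (2 * real m)"
    by (intro divide_right_mono) auto
  then have "- (real j * (real j - 1) / (2 * real m)) \<le>
      - (real n * (real n - 1) / (2 * real m)) + real k * (real n / real m)"
    by (simp add: diff_divide_distrib mult.commute)
  then have "no_collision m j \<le>
      exp (- (real n * (real n - 1) / (2 * real m)) + real k * (real n / real m))"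
    using no_collision_le[OF assms(3), of j] by (smt (verit) exp_le_cancel_iff)
  then have nc: "no_collision m j \<le>
      exp (- (real n * (real n - 1) / (2 * real m))) * exp (real n / real m) ^ k"
    by (simp only: exp_add exp_of_nat_mult)
  have "fact n / fact j \<le> real n ^ k"
  proof -
    have "fact n div fact (n - k) \<le> n ^ k"
      using assms by (intro fact_div_fact_le_pow) simp
    then have "real (fact n div fact j) \<le> real (n ^ k)"
      unfolding j_def by (simp only: of_nat_le_iff)
    moreover have "real (fact n div fact j) = fact n / fact j"
      by (simp add: real_of_nat_div fact_dvd n)
    ultimately show ?thesis by simp
  qed
  moreover have "real (n - 1 choose k) \<le> real n ^ k / fact k"
  proof -
    have "(n - 1 choose k) * fact k \<le> n ^ k"
      using binomial_fact_pow[of "n - 1" k] power_mono[of "n - 1" n k] by linarith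
    then have "real ((n - 1 choose k) * fact k) \<le> real (n ^ k)"
      by (simp only: of_nat_le_iff)
    then show ?thesis by (simp add: field_simps)
  qed
  ultimately have fc: "(fact n / fact j) * real (n - 1 choose k) \<le> real n ^ k * (real n ^ k / fact k)"
    by (intro mult_mono) auto
  have "fact n / real m ^ n * (real (m choose j) * (real (n - 1 choose k) * r ^ k)) =
      no_collision m j * ((fact n / fact j * real (n - 1 choose k)) * (r / real m) ^ k)"
    using assms by (simp add: choose_eq_no_collision n power_add power_divide field_simps)
  also have "\<dots> \<le> (exp (- (real n * (real n - 1) / (2 * real m))) * exp (real n / real m) ^ k) *
      ((real n ^ k * (real n ^ k / fact k)) * (r / real m) ^ k)"
    using assms by (intro mult_mono[OF nc] mult_right_mono[OF fc]) auto
  also have "\<dots> = exp (- (real n * (real n - 1) / (2 * real m))) *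
      ((r * real n ^ 2 / real m * exp (real n / real m)) ^ k / fact k)"
    by (simp add: power_mult_distrib power_divide power2_eq_square mult_ac)
  finally show ?thesis by (simp add: j_def)
qed

lemma normalised_geometric_coeff_le:
  assumes "0 \<le> r" "n > 0" "m > 0"
  shows "fact n * (fps_nth ((1 + fps_X * Abs_fps (\<lambda>i. r ^ i)) ^ m) n / real m ^ n)
    \<le> exp (- (real n * (real n - 1) / (2 * real m)) + r * real n ^ 2 / real m * exp (real n / real m))"
proof -
  let ?H = "Abs_fps (\<lambda>i. r ^ i)" and ?y = "r * real n ^ 2 / real m * exp (real n / real m)"
  have "fact n * (fps_nth ((1 + fps_X * ?H) ^ m) n / real m ^ n) =
      (\<Sum>k\<le>n. fact n / real m ^ n * (real (m choose (n - k)) * fps_nth (?H ^ (n - k)) k))"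
    by (simp add: fps_nth_power_one_plus_X_mult sum_distrib_left sum_divide_distrib)
  also have "\<dots> \<le> (\<Sum>k\<le>n. exp (- (real n * (real n - 1) / (2 * real m))) * (?y ^ k / fact k))"
  proof (rule sum_mono)
    fix k assume "k \<in> {..n}"
    \<comment> \<open>For \<open>k = n\<close> no shelf is occupied, and the coefficient of \<open>?H ^ 0 = 1\<close> vanishes as \<open>n > 0\<close>.\<close>
    then consider "k = n" | "k < n" by fastforce
    then show "fact n / real m ^ n * (real (m choose (n - k)) * fps_nth (?H ^ (n - k)) k)
        \<le> exp (- (real n * (real n - 1) / (2 * real m))) * (?y ^ k / fact k)"
    proof cases
      case 1
      with assms show ?thesis by simp
    next
      case 2
      then have "fps_nth (?H ^ (n - k)) k = real (n - 1 choose k) * r ^ k"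
        by (subst fps_nth_power_geometric) auto
      with birthday_coeff_le[OF assms(1) 2 assms(3)] show ?thesis by simp
    qed
  qed
  also have "\<dots> = exp (- (real n * (real n - 1) / (2 * real m))) * (\<Sum>k\<le>n. ?y ^ k / fact k)"
    by (simp add: sum_distrib_left)
  also have "\<dots> \<le> exp (- (real n * (real n - 1) / (2 * real m))) * exp ?y"
    using assms by (intro mult_left_mono sum_exp_le) auto
  finally show ?thesis by (simp only: exp_add)
qed

section \<open>Separation from the uniform measure and its limit\<close>

lemma pmf_uniform_perm:
  assumes "xs \<in> permutations_of_set {1..n}"
  shows "pmf (uniform_perm n) xs = 1 / fact n"
  using assms unfolding uniform_perm_def
  by (subst pmf_of_set) (auto simp: card_permutations_of_set)

lemma separation_uniform_eq:
  "separation n \<mu> (uniform_perm n) =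
    (MAX xs\<in>permutations_of_set {1..n}. 1 - fact n * pmf \<mu> xs)"
  unfolding separation_def
  by (intro arg_cong[where f = Max] image_cong) (auto simp: pmf_uniform_perm)

lemma separation_uniform_le:
  assumes "\<And>xs. xs \<in> permutations_of_set {1..n} \<Longrightarrow> a \<le> fact n * pmf \<mu> xs"
  shows "separation n \<mu> (uniform_perm n) \<le> 1 - a"
  unfolding separation_uniform_eq by (subst Max_le_iff) (use assms in auto)

lemma separation_uniform_ge:
  assumes "xs \<in> permutations_of_set {1..n}" "fact n * pmf \<mu> xs \<le> a"
  shows "1 - a \<le> separation n \<mu> (uniform_perm n)"
  unfolding separation_uniform_eq by (subst Max_ge_iff) (use assms in auto)

lemma nat_floor_asymptotics:
  fixes c :: real
  assumes "c > 0"
  defines "M \<equiv> \<lambda>n. real (nat \<lfloor>c * real n ^ 2\<rfloor>)"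
  shows "(\<lambda>n. real n ^ 2 / M n) \<longlonglongrightarrow> 1 / c"
    and "(\<lambda>n. real n / M n) \<longlonglongrightarrow> 0"
    and "(\<lambda>n. real n ^ 2 / (M n - real n)) \<longlonglongrightarrow> 1 / c"
    and "eventually (\<lambda>n. real n < M n) sequentially"
proof -
  have inv: "(\<lambda>n. 1 / real n) \<longlonglongrightarrow> 0"
    by (rule lim_1_over_n)
  have pos: "eventually (\<lambda>n. n > (0::nat)) sequentially"
    by (rule eventually_gt_at_top)
  have M: "c * real n ^ 2 - 1 \<le> M n" "M n \<le> c * real n ^ 2" for n
  proof -
    have "M n = of_int \<lfloor>c * real n ^ 2\<rfloor>"
      using assms by (simp add: M_def)
    then show "c * real n ^ 2 - 1 \<le> M n" "M n \<le> c * real n ^ 2"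
      by linarith+
  qed
  have q: "(\<lambda>n. M n / real n ^ 2) \<longlonglongrightarrow> c"
  proof (rule tendsto_sandwich)
    show "eventually (\<lambda>n. c - 1 / real n * (1 / real n) \<le> M n / real n ^ 2) sequentially"
      using pos
    proof eventually_elim
      case (elim n)
      then have "c - 1 / real n * (1 / real n) = (c * real n ^ 2 - 1) / real n ^ 2"
        by (simp add: field_simps power2_eq_square)
      also have "\<dots> \<le> M n / real n ^ 2"
        using M(1) by (intro divide_right_mono) auto
      finally show ?case .
    qed
    show "eventually (\<lambda>n. M n / real n ^ 2 \<le> c) sequentially"
      using pos by eventually_elim (use M(2) in \<open>simp add: field_simps\<close>)
    have "(\<lambda>n. c - 1 / real n * (1 / real n)) \<longlonglongrightarrow> c - 0 * 0"
      by (intro tendsto_intros inv)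
    then show "(\<lambda>n. c - 1 / real n * (1 / real n)) \<longlonglongrightarrow> c" by simp
  qed auto
  have "(\<lambda>n. 1 / (M n / real n ^ 2)) \<longlonglongrightarrow> 1 / c"
    using assms by (intro tendsto_intros q) auto
  then show 1: "(\<lambda>n. real n ^ 2 / M n) \<longlonglongrightarrow> 1 / c"
    by simp
  have "(\<lambda>n. real n ^ 2 / M n * (1 / real n)) \<longlonglongrightarrow> 1 / c * 0"
    by (intro tendsto_mult 1 inv)
  moreover have "eventually (\<lambda>n. real n ^ 2 / M n * (1 / real n) = real n / M n) sequentially"
    using pos by eventually_elim (simp add: power2_eq_square)
  ultimately show "(\<lambda>n. real n / M n) \<longlonglongrightarrow> 0"
    by (simp add: tendsto_cong)
  have d: "(\<lambda>n. M n / real n ^ 2 - 1 / real n) \<longlonglongrightarrow> c - 0"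
    by (intro tendsto_diff q inv)
  then have "(\<lambda>n. 1 / (M n / real n ^ 2 - 1 / real n)) \<longlonglongrightarrow> 1 / (c - 0)"
    using assms by (intro tendsto_divide tendsto_const) auto
  moreover have "eventually (\<lambda>n. 1 / (M n / real n ^ 2 - 1 / real n) = real n ^ 2 / (M n - real n)) sequentially"
    using pos
  proof eventually_elim
    case (elim n)
    then have "M n / real n ^ 2 - 1 / real n = (M n - real n) / real n ^ 2"
      by (simp add: diff_divide_distrib power2_eq_square)
    then show ?case by simp
  qed
  ultimately show "(\<lambda>n. real n ^ 2 / (M n - real n)) \<longlonglongrightarrow> 1 / c"
    by (simp add: tendsto_cong)
  have "eventually (\<lambda>n. M n / real n ^ 2 - 1 / real n > 0) sequentially"
    using order_tendstoD(1)[OF d, of 0] assms by simp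
  then show "eventually (\<lambda>n. real n < M n) sequentially"
    using pos by eventually_elim (simp add: field_simps power2_eq_square)
qed

theorem theorem1p7:
  fixes p c :: real
  assumes "0 < p" and "p < 1" and "p \<noteq> 1 / 2" and "c > 0"
  shows "(\<lambda>n. separation n (shelf_shuffle n (nat \<lfloor>c * real n ^ 2\<rfloor>) p) (uniform_perm n))
           \<longlonglongrightarrow> 1 - exp (- (\<bar>2 * p - 1\<bar> / (2 * c)))"
proof -
  define m where "m n = nat \<lfloor>c * real n ^ 2\<rfloor>" for n
  define r where "r = min p (1 - p)"
  define S where "S n = separation n (shelf_shuffle n (m n) p) (uniform_perm n)" for n
  define L where "L = exp (- (\<bar>2 * p - 1\<bar> / (2 * c)))"
  have r: "0 \<le> r" "r \<le> p" "r \<le> 1 - p"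
    using assms by (auto simp: r_def)
  have "- (1 / c / 2) + r * (1 / c) = - ((1 - 2 * r) / (2 * c))"
    using assms by (simp add: field_simps)
  also have "1 - 2 * r = \<bar>2 * p - 1\<bar>"
    by (simp add: r_def min_def)
  finally have exponent: "exp (- (1 / c / 2) + r * (1 / c)) = L"
    by (simp add: L_def)
  note lim = nat_floor_asymptotics[OF assms(4), folded m_def]
  have pos: "eventually (\<lambda>n. n > (0::nat)) sequentially"
    by (rule eventually_gt_at_top)
  have large: "eventually (\<lambda>n. n < m n) sequentially"
    using lim(4) by simp
  define upper where "upper n = exp (- (real n * (real n - 1) / (2 * real (m n))) +
      r * real n ^ 2 / real (m n) * exp (real n / real (m n)))" for n
  define lower where "lower K n = exp (- (real n ^ 2 / (2 * (real (m n) - real n)))) *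
      (\<Sum>k<K. (r * (real n - 2 * real k) ^ 2 / real (m n)) ^ k / fact k)" for K n
  have upper_lim: "upper \<longlonglongrightarrow> L"
  proof -
    have "(\<lambda>n. exp (- ((real n ^ 2 / real (m n) - real n / real (m n)) / 2) +
        r * (real n ^ 2 / real (m n)) * exp (real n / real (m n))))
        \<longlonglongrightarrow> exp (- ((1 / c - 0) / 2) + r * (1 / c) * exp 0)"
      by (intro tendsto_intros lim) simp
    also have "exp (- ((1 / c - 0) / 2) + r * (1 / c) * exp 0) = L"
      using exponent by simp
    finally show ?thesis
      by (simp add: upper_def[abs_def] algebra_simps diff_divide_distrib power2_eq_square)
  qed
  have lower_lim: "lower K \<longlonglongrightarrow> exp (- (1 / c / 2)) * (\<Sum>k<K. (r * (1 / c)) ^ k / fact k)" for K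
  proof -
    have shift: "(\<lambda>n. r * (real n - 2 * real k) ^ 2 / real (m n)) \<longlonglongrightarrow> r * (1 / c)" for k
    proof -
      have "(\<lambda>n. r * (real n ^ 2 / real (m n) - 4 * real k * (real n / real (m n))
          + 4 * real k ^ 2 * (real n / real (m n) * (1 / real n)))) \<longlonglongrightarrow>
          r * (1 / c - 4 * real k * 0 + 4 * real k ^ 2 * (0 * 0))"
        by (intro tendsto_intros lim lim_1_over_n)
      moreover have "eventually (\<lambda>n. r * (real n ^ 2 / real (m n) - 4 * real k * (real n / real (m n))
          + 4 * real k ^ 2 * (real n / real (m n) * (1 / real n))) =
          r * (real n - 2 * real k) ^ 2 / real (m n)) sequentially"
        using pos large
        by eventually_elim (simp add: field_simps power2_eq_square)
      ultimately show ?thesis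
        by (simp add: tendsto_cong)
    qed
    have "(\<lambda>n. exp (- (real n ^ 2 / (real (m n) - real n) / 2)) *
        (\<Sum>k<K. (r * (real n - 2 * real k) ^ 2 / real (m n)) ^ k / fact k))
        \<longlonglongrightarrow> exp (- (1 / c / 2)) * (\<Sum>k<K. (r * (1 / c)) ^ k / fact k)"
      by (intro tendsto_intros lim shift) auto
    then show ?thesis
      by (simp add: lower_def[abs_def] mult.commute)
  qed
  have S_ge: "eventually (\<lambda>n. 1 - upper n \<le> S n) sequentially"
    using pos large
  proof eventually_elim
    case (elim n)
    then obtain xs where xs: "xs \<in> permutations_of_set {1..n}"
      and le: "pmf (shelf_shuffle n (m n) p) xs
        \<le> fps_nth ((1 + fps_X * Abs_fps (\<lambda>i. r ^ i)) ^ m n) n / real (m n) ^ n"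
      using ex_pmf_shelf_shuffle_le[of "m n" p n] assms by (auto simp: r_def)
    have "fact n * pmf (shelf_shuffle n (m n) p) xs
        \<le> fact n * (fps_nth ((1 + fps_X * Abs_fps (\<lambda>i. r ^ i)) ^ m n) n / real (m n) ^ n)"
      using le by (intro mult_left_mono) auto
    also have "\<dots> \<le> upper n"
      unfolding upper_def using elim r by (intro normalised_geometric_coeff_le) auto
    finally show ?case
      unfolding S_def by (rule separation_uniform_ge[OF xs])
  qed
  have S_le: "eventually (\<lambda>n. S n \<le> 1 - lower K n) sequentially" for K
    using eventually_ge_at_top[of "2 * K"] large
  proof eventually_elim
    case (elim n)
    show ?case
      unfolding S_def
    proof (rule separation_uniform_le)
      fix xs assume "xs \<in> permutations_of_set {1..n}"
      then have "fact n * (fps_nth ((1 + fps_X * (1 + fps_const r * fps_X)) ^ m n) n / real (m n) ^ n)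
          \<le> fact n * pmf (shelf_shuffle n (m n) p) xs"
        using elim r by (intro mult_left_mono pmf_shelf_shuffle_ge) auto
      moreover have "lower K n
          \<le> fact n * (fps_nth ((1 + fps_X * (1 + fps_const r * fps_X)) ^ m n) n / real (m n) ^ n)"
        unfolding lower_def using elim r by (intro normalised_linear_coeff_ge) auto
      ultimately show "lower K n \<le> fact n * pmf (shelf_shuffle n (m n) p) xs"
        by linarith
    qed
  qed
  have "S \<longlonglongrightarrow> 1 - L"
  proof (rule order_tendstoI)
    fix a assume "a < 1 - L"
    moreover have "(\<lambda>n. 1 - upper n) \<longlonglongrightarrow> 1 - L"
      by (intro tendsto_intros upper_lim)
    ultimately have "eventually (\<lambda>n. a < 1 - upper n) sequentially"
      by (rule order_tendstoD(1)[rotated])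
    then show "eventually (\<lambda>n. a < S n) sequentially"
      using S_ge by eventually_elim simp
  next
    fix a assume a: "1 - L < a"
    have "(\<lambda>k. (r * (1 / c)) ^ k / fact k) sums exp (r * (1 / c))"
      using exp_converges[of "r * (1 / c)"] by (simp add: field_simps)
    then have "(\<lambda>K. 1 - exp (- (1 / c / 2)) * (\<Sum>k<K. (r * (1 / c)) ^ k / fact k))
        \<longlonglongrightarrow> 1 - exp (- (1 / c / 2)) * exp (r * (1 / c))"
      unfolding sums_def by (intro tendsto_intros)
    then have "(\<lambda>K. 1 - exp (- (1 / c / 2)) * (\<Sum>k<K. (r * (1 / c)) ^ k / fact k)) \<longlonglongrightarrow> 1 - L"
      by (simp only: exponent exp_add[symmetric])
    \<comment> \<open>The bound \<open>lower K\<close> has a limit for each \<open>K\<close>; so \<open>K\<close> is fixed before \<open>n\<close> grows.\<close>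
    from order_tendstoD(2)[OF this a] obtain K
      where K: "1 - exp (- (1 / c / 2)) * (\<Sum>k<K. (r * (1 / c)) ^ k / fact k) < a"
      by (auto simp: eventually_sequentially)
    have "(\<lambda>n. 1 - lower K n) \<longlonglongrightarrow> 1 - exp (- (1 / c / 2)) * (\<Sum>k<K. (r * (1 / c)) ^ k / fact k)"
      by (intro tendsto_intros lower_lim)
    from order_tendstoD(2)[OF this K]
    show "eventually (\<lambda>n. S n < a) sequentially"
      using S_le[of K] by eventually_elim simp
  qed
  then show ?thesis
    by (simp add: S_def[abs_def] m_def[abs_def] L_def)
qed

end
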